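(* Let $G=\mathrm{GIRG}(n,\beta,w_0,d)$ be a standard GIRG with $\beta<3$. Then $\omega(G)=\Omega(n^{(3-\beta)/2})$ asymptotically almost surely.
   Context: Fix constants $\lambda>0$, $w_0>0$, $\beta>2$. A standard GIRG $\mathrm{GIRG}(n,\beta,w_0,d)$ has $n$ vertices; each vertex $v$ independently receives a weight $w_v$ with $\Pr[w_v\le x]=1-(x/w_0)^{1-\beta}$ for $x\ge w_0$, and independently a position $\mathbf{x}_v$ uniform on the torus $\mathbb{T}^d=[0,1)^d$. The distance is $d(\mathbf{x}_u,\mathbf{x}_v)=\max_{1\le i\le d}|x_{ui}-x_{vi}|_C$ with $|a-b|_C=\min\{|a-b|,1-|a-b|\}$. Distinct $u,v$ are adjacent iff $d(\mathbf{x}_u,\mathbf{x}_v)\le \frac12\big(\frac{\lambda w_uw_v}{n}\big)^{1/d}$. The dimension $d=d(n)$ may depend on $n$. $\omega(G)$ is the size of the largest clique; "asymptotically almost surely" means with probability $1-o(1)$ as $n\to\infty$. *)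

theory Defs
  imports "HOL-Probability.Probability" "HOL-Library.Ramsey"
begin

definition circ_dist :: "real \<Rightarrow> real \<Rightarrow> real" where
  "circ_dist a b = min \<bar>a - b\<bar> (1 - \<bar>a - b\<bar>)"

text \<open>Points of the \<open>d\<close>-dimensional torus are functions on the coordinate set \<open>{..<d}\<close>;
  the maximum is meaningful for \<open>d \<ge> 1\<close> only.\<close>

definition torus_dist :: "nat \<Rightarrow> (nat \<Rightarrow> real) \<Rightarrow> (nat \<Rightarrow> real) \<Rightarrow> real" where
  "torus_dist d x y = Max ((\<lambda>i. circ_dist (x i) (y i)) ` {..<d})"

definition torus_uniform :: "nat \<Rightarrow> (nat \<Rightarrow> real) measure" where
  "torus_uniform d = uniform_measure (\<Pi>\<^sub>M i\<in>{..<d}. lborel) (\<Pi>\<^sub>E i\<in>{..<d}. {0..<1})"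

text \<open>The random data of a GIRG with vertex set \<open>{..<n}\<close>: \<open>W v\<close> and \<open>X v\<close> are the weight and the
  position of \<open>v\<close>. All weights and positions are mutually independent: the pairs \<open>(W v, X v)\<close> are
  independent over \<open>v\<close>, and within each pair the weight is independent of the position. The latter is stated
  through the generated sigma-algebras, since \<open>indep_var\<close> requires both variables to have the same
  type. Measurability of \<open>W v\<close> and \<open>X v\<close> is part of the independence of the pairs.\<close>

locale girg = prob_space M
  for M :: "'a measure" and n :: nat and \<beta> w0 :: real and d :: nat
    and W :: "nat \<Rightarrow> 'a \<Rightarrow> real" and X :: "nat \<Rightarrow> 'a \<Rightarrow> nat \<Rightarrow> real" +
  assumes dim_pos: "1 \<le> d"
    and vertices_indep:
      "indep_vars (\<lambda>v. borel \<Otimes>\<^sub>M (\<Pi>\<^sub>M i\<in>{..<d}. lborel)) (\<lambda>v \<omega>. (W v \<omega>, X v \<omega>)) {..<n}"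
    and weight_position_indep:
      "\<And>v. v < n \<Longrightarrow> indep_set
         {W v -` A \<inter> space M | A. A \<in> sets borel}
         {X v -` B \<inter> space M | B. B \<in> sets (\<Pi>\<^sub>M i\<in>{..<d}. lborel)}"
    and weight_cdf:
      "\<And>v x. v < n \<Longrightarrow> w0 \<le> x \<Longrightarrow> prob {\<omega> \<in> space M. W v \<omega> \<le> x} = 1 - (x / w0) powr (1 - \<beta>)"
    and position_uniform:
      "\<And>v. v < n \<Longrightarrow> distr M (\<Pi>\<^sub>M i\<in>{..<d}. lborel) (X v) = torus_uniform d"

definition girg_edges ::
  "real \<Rightarrow> nat \<Rightarrow> nat \<Rightarrow> (nat \<Rightarrow> real) \<Rightarrow> (nat \<Rightarrow> nat \<Rightarrow> real) \<Rightarrow> nat set set" where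
  "girg_edges lam n d w x = {{u, v} | u v. u < n \<and> v < n \<and> u \<noteq> v \<and>
     torus_dist d (x u) (x v) \<le> 1 / 2 * (lam * w u * w v / real n) powr (1 / real d)}"

definition clique_number :: "'v set \<Rightarrow> 'v set set \<Rightarrow> nat" where
  "clique_number V E = Max (card ` {C. C \<subseteq> V \<and> clique C E})"

end

theory Submission
  imports Defs "HOL-Real_Asymp.Real_Asymp"
begin

text \<open>Two points of the torus are at distance at most 1/2, so any two vertices whose weights have
  product at least \<open>n / \<lambda>\<close> are adjacent, whatever their positions and the dimension. Hence the
  vertices of weight above \<open>B \<surd>n\<close>, where \<open>B = max w\<^sub>0 (1 / \<surd>\<lambda>)\<close>, form a clique. Their number is
  binomial with mean \<open>(B / w\<^sub>0)\<^bsup>1 - \<beta>\<^esup> n\<^bsup>(3 - \<beta>)/2\<^esup>\<close>, which tends to infinity for \<open>\<beta> < 3\<close>,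
  and a Chernoff bound shows that it is at least half of its mean asymptotically almost surely.
  The mean is \<open>o(\<surd>n)\<close>, so Hoeffding's inequality is too weak here; the lower tail is instead
  controlled through \<open>exp (- x) \<le> 1 - x + x\<^sup>2 / 2\<close> for \<open>x \<ge> 0\<close>.\<close>

section \<open>The lower tail of a sum of independent nonnegative random variables\<close>

lemma exp_minus_upper_Taylor_quadratic:
  fixes x :: real
  assumes "0 \<le> x"
  shows "exp (- x) \<le> 1 - x + x\<^sup>2 / 2"
proof -
  have "1 \<le> (1 + x + x\<^sup>2 / 2) * (1 - x + x\<^sup>2 / 2)"
  proof -
    have "(1 + x + x\<^sup>2 / 2) * (1 - x + x\<^sup>2 / 2) = 1 + (x\<^sup>2 / 2)\<^sup>2"
      by (simp add: power2_eq_square algebra_simps)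
    then show ?thesis
      by simp
  qed
  also have "\<dots> \<le> exp x * (1 - x + x\<^sup>2 / 2)"
  proof (rule mult_right_mono)
    have "0 \<le> ((1 - x)\<^sup>2 + 1) / 2"
      by simp
    also have "\<dots> = 1 - x + x\<^sup>2 / 2"
      by (simp add: power2_eq_square field_simps)
    finally show "0 \<le> 1 - x + x\<^sup>2 / 2" .
  qed (rule exp_lower_Taylor_quadratic[OF assms])
  finally show ?thesis
    by (simp add: exp_minus field_simps)
qed

context prob_space
begin

lemma integrable_exp_minus:
  fixes X :: "'a \<Rightarrow> real"
  assumes "X \<in> borel_measurable M" "AE \<omega> in M. 0 \<le> X \<omega>" "0 \<le> s"
  shows "integrable M (\<lambda>\<omega>. exp (- s * X \<omega>))"
proof (rule integrable_const_bound[where B = 1])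
  show "AE \<omega> in M. norm (exp (- s * X \<omega>)) \<le> 1"
    using assms(2) by eventually_elim (use \<open>0 \<le> s\<close> in simp)
qed (use assms(1) in measurable)

lemma expectation_exp_minus_le:
  fixes X :: "'a \<Rightarrow> real"
  assumes X: "X \<in> borel_measurable M" and nonneg: "AE \<omega> in M. 0 \<le> X \<omega>"
    and square: "integrable M (\<lambda>\<omega>. (X \<omega>)\<^sup>2)" and "0 \<le> s"
  shows "expectation (\<lambda>\<omega>. exp (- s * X \<omega>))
    \<le> exp (s\<^sup>2 / 2 * expectation (\<lambda>\<omega>. (X \<omega>)\<^sup>2) - s * expectation X)"
proof -
  have int: "integrable M X"
    using X square by (rule square_integrable_imp_integrable)
  have "expectation (\<lambda>\<omega>. exp (- s * X \<omega>))
      \<le> expectation (\<lambda>\<omega>. 1 - s * X \<omega> + s\<^sup>2 / 2 * (X \<omega>)\<^sup>2)"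
  proof (rule integral_mono_AE)
    show "AE \<omega> in M. exp (- s * X \<omega>) \<le> 1 - s * X \<omega> + s\<^sup>2 / 2 * (X \<omega>)\<^sup>2"
      using nonneg
    proof eventually_elim
      case (elim \<omega>)
      then show ?case
        using exp_minus_upper_Taylor_quadratic[of "s * X \<omega>"] \<open>0 \<le> s\<close>
        by (simp add: power_mult_distrib)
    qed
  qed (use int square integrable_exp_minus[OF X nonneg \<open>0 \<le> s\<close>] in simp_all)
  also have "\<dots> = 1 + (s\<^sup>2 / 2 * expectation (\<lambda>\<omega>. (X \<omega>)\<^sup>2) - s * expectation X)"
    using int square by (simp add: prob_space)
  also have "\<dots> \<le> exp (s\<^sup>2 / 2 * expectation (\<lambda>\<omega>. (X \<omega>)\<^sup>2) - s * expectation X)"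
    by (rule exp_ge_add_one_self)
  finally show ?thesis .
qed

lemma
  fixes X :: "'i \<Rightarrow> 'a \<Rightarrow> real"
  assumes fin: "finite I" and indep: "indep_vars (\<lambda>_. borel) X I"
    and nonneg: "\<And>i. i \<in> I \<Longrightarrow> AE \<omega> in M. 0 \<le> X i \<omega>"
    and square: "\<And>i. i \<in> I \<Longrightarrow> integrable M (\<lambda>\<omega>. (X i \<omega>)\<^sup>2)" and s: "0 \<le> s"
  shows integrable_exp_minus_sum: "integrable M (\<lambda>\<omega>. exp (- s * (\<Sum>i\<in>I. X i \<omega>)))"
    and expectation_exp_minus_sum_le: "expectation (\<lambda>\<omega>. exp (- s * (\<Sum>i\<in>I. X i \<omega>)))
      \<le> exp (s\<^sup>2 / 2 * (\<Sum>i\<in>I. expectation (\<lambda>\<omega>. (X i \<omega>)\<^sup>2)) - s * (\<Sum>i\<in>I. expectation (X i)))"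
proof -
  have X: "X i \<in> borel_measurable M" if "i \<in> I" for i
    using indep that by (simp add: indep_vars_def2)
  have indep_exp: "indep_vars (\<lambda>_. borel) (\<lambda>i \<omega>. exp (- s * X i \<omega>)) I"
    using indep by (rule indep_vars_compose2) simp
  have int_exp: "integrable M (\<lambda>\<omega>. exp (- s * X i \<omega>))" if "i \<in> I" for i
    using X[OF that] nonneg[OF that] s by (rule integrable_exp_minus)
  have prod: "exp (- s * (\<Sum>i\<in>I. X i \<omega>)) = (\<Prod>i\<in>I. exp (- s * X i \<omega>))" for \<omega>
    using fin by (simp add: sum_distrib_left exp_sum flip: sum_negf)
  show "integrable M (\<lambda>\<omega>. exp (- s * (\<Sum>i\<in>I. X i \<omega>)))"
    unfolding prod using fin indep_exp int_exp by (rule indep_vars_integrable)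
  have "expectation (\<lambda>\<omega>. exp (- s * (\<Sum>i\<in>I. X i \<omega>))) = (\<Prod>i\<in>I. expectation (\<lambda>\<omega>. exp (- s * X i \<omega>)))"
    unfolding prod using fin indep_exp int_exp by (rule indep_vars_lebesgue_integral)
  also have "\<dots> \<le> (\<Prod>i\<in>I. exp (s\<^sup>2 / 2 * expectation (\<lambda>\<omega>. (X i \<omega>)\<^sup>2) - s * expectation (X i)))"
    using expectation_exp_minus_le[OF X nonneg square s] by (intro prod_mono) auto
  also have "\<dots> = exp (s\<^sup>2 / 2 * (\<Sum>i\<in>I. expectation (\<lambda>\<omega>. (X i \<omega>)\<^sup>2)) - s * (\<Sum>i\<in>I. expectation (X i)))"
    using fin by (simp add: sum_distrib_left sum_subtractf flip: exp_sum)
  finally show "expectation (\<lambda>\<omega>. exp (- s * (\<Sum>i\<in>I. X i \<omega>)))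
      \<le> exp (s\<^sup>2 / 2 * (\<Sum>i\<in>I. expectation (\<lambda>\<omega>. (X i \<omega>)\<^sup>2)) - s * (\<Sum>i\<in>I. expectation (X i)))" .
qed

text \<open>If \<open>q = 0\<close>, the right-hand side is \<open>exp 0 = 1\<close>, as division by zero yields zero.\<close>

lemma prob_sum_le_expectation_minus:
  fixes X :: "'i \<Rightarrow> 'a \<Rightarrow> real"
  assumes fin: "finite I" and indep: "indep_vars (\<lambda>_. borel) X I"
    and nonneg: "\<And>i. i \<in> I \<Longrightarrow> AE \<omega> in M. 0 \<le> X i \<omega>"
    and square: "\<And>i. i \<in> I \<Longrightarrow> integrable M (\<lambda>\<omega>. (X i \<omega>)\<^sup>2)" and "0 \<le> \<epsilon>"
  defines "\<mu> \<equiv> \<Sum>i\<in>I. expectation (X i)"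
    and "q \<equiv> \<Sum>i\<in>I. expectation (\<lambda>\<omega>. (X i \<omega>)\<^sup>2)"
  shows "prob {\<omega> \<in> space M. (\<Sum>i\<in>I. X i \<omega>) \<le> \<mu> - \<epsilon>} \<le> exp (- \<epsilon>\<^sup>2 / (2 * q))"
proof (cases "0 < q \<and> 0 < \<epsilon>")
  case True
  define s where "s = \<epsilon> / q"
  then have s: "0 < s"
    using True by simp
  have int: "integrable M (\<lambda>\<omega>. exp (- s * (\<Sum>i\<in>I. X i \<omega>)))"
    using fin indep nonneg square less_imp_le[OF s] by (rule integrable_exp_minus_sum)
  have "prob {\<omega> \<in> space M. (\<Sum>i\<in>I. X i \<omega>) \<le> \<mu> - \<epsilon>}
      \<le> exp (s * (\<mu> - \<epsilon>)) * expectation (\<lambda>\<omega>. exp (- s * (\<Sum>i\<in>I. X i \<omega>)))"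
    using Chernoff_ineq_le[OF s, of "space M" "\<lambda>\<omega>. \<Sum>i\<in>I. X i \<omega>" "\<mu> - \<epsilon>"]
      integrable_mult_indicator[OF sets.top int]
    by (simp only: set_integrable_def set_integral_space[OF int] sets.top)
  also have "\<dots> \<le> exp (s * (\<mu> - \<epsilon>)) * exp (s\<^sup>2 / 2 * q - s * \<mu>)"
    unfolding \<mu>_def q_def
    using expectation_exp_minus_sum_le[OF fin indep nonneg square less_imp_le[OF s]]
    by (intro mult_left_mono) auto
  also have "\<dots> = exp (- \<epsilon>\<^sup>2 / (2 * q))"
    using True by (simp add: s_def power2_eq_square field_simps flip: exp_add)
  finally show ?thesis .
next
  case False
  moreover have "0 \<le> q"
    unfolding q_def by (intro sum_nonneg integral_nonneg) simp
  ultimately have "q = 0 \<or> \<epsilon> = 0"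
    using \<open>0 \<le> \<epsilon>\<close> by auto
  then show ?thesis
    by auto
qed

lemma indep_vars_indicator:
  assumes "indep_events A I"
  shows "indep_vars (\<lambda>_. borel) (\<lambda>i. indicator (A i) :: 'a \<Rightarrow> real) I"
  unfolding indep_vars_def2
proof
  have A: "A i \<in> events" if "i \<in> I" for i
    using assms that by (auto simp: indep_events_def)
  then show "\<forall>i\<in>I. random_variable borel (indicator (A i) :: 'a \<Rightarrow> real)"
    by simp
  have "indep_sets (\<lambda>i. sigma_sets (space M) {A i}) I"
    using assms unfolding indep_events_def_alt by (rule indep_sets_sigma) (simp add: Int_stable_def)
  then show "indep_sets (\<lambda>i. {(indicator (A i) :: 'a \<Rightarrow> real) -` B \<inter> space M |B. B \<in> sets borel}) I"
  proof (rule indep_sets_mono_sets)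
    fix i assume "i \<in> I"
    then have "A i \<subseteq> space M"
      using A sets.sets_into_space by blast
    then have [measurable]: "A i \<in> sets (sigma (space M) {A i})"
      by (intro in_measure_of) auto
    have "indicator (A i) \<in> measurable (sigma (space M) {A i}) (borel :: real measure)"
      by measurable
    note measurable_sets[OF this]
    then show "{(indicator (A i) :: 'a \<Rightarrow> real) -` B \<inter> space M |B. B \<in> sets borel}
        \<subseteq> sigma_sets (space M) {A i}"
      using \<open>A i \<subseteq> space M\<close> by auto
  qed
qed

lemma Chernoff_ineq_indep_events_le:
  assumes fin: "finite I" and indep: "indep_events A I" and "0 \<le> \<delta>"
  defines "\<mu> \<equiv> \<Sum>i\<in>I. prob (A i)"
  shows "prob {\<omega> \<in> space M. real (card {i\<in>I. \<omega> \<in> A i}) \<le> (1 - \<delta>) * \<mu>} \<le> exp (- \<delta>\<^sup>2 * \<mu> / 2)"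
proof -
  let ?X = "\<lambda>i. indicator (A i) :: 'a \<Rightarrow> real"
  have A[measurable]: "A i \<in> events" if "i \<in> I" for i
    using indep that by (auto simp: indep_events_def)
  have "0 \<le> \<mu>"
    unfolding \<mu>_def by (intro sum_nonneg) simp
  have square: "(\<lambda>\<omega>. (?X i \<omega>)\<^sup>2) = ?X i" for i
    by (auto simp: indicator_def)
  have expectation: "(\<Sum>i\<in>I. expectation (?X i)) = \<mu>"
    unfolding \<mu>_def using A by (intro sum.cong) auto
  have count: "(\<Sum>i\<in>I. ?X i \<omega>) = real (card {i\<in>I. \<omega> \<in> A i})" for \<omega>
    using fin by (simp add: indicator_def sum.If_cases Int_def)
  have "prob {\<omega> \<in> space M. (\<Sum>i\<in>I. ?X i \<omega>) \<le> (\<Sum>i\<in>I. expectation (?X i)) - \<delta> * \<mu>}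
      \<le> exp (- (\<delta> * \<mu>)\<^sup>2 / (2 * (\<Sum>i\<in>I. expectation (\<lambda>\<omega>. (?X i \<omega>)\<^sup>2))))"
    using A \<open>0 \<le> \<delta>\<close> \<open>0 \<le> \<mu>\<close>
    by (intro prob_sum_le_expectation_minus[OF fin indep_vars_indicator[OF indep]])
      (auto simp: square integrable_indicator_iff emeasure_eq_measure)
  then have "prob {\<omega> \<in> space M. real (card {i\<in>I. \<omega> \<in> A i}) \<le> \<mu> - \<delta> * \<mu>}
      \<le> exp (- (\<delta> * \<mu>)\<^sup>2 / (2 * \<mu>))"
    unfolding square expectation count .
  moreover have "- (\<delta> * \<mu>)\<^sup>2 / (2 * \<mu>) = - \<delta>\<^sup>2 * \<mu> / 2"
    by (simp add: power2_eq_square)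
  ultimately show ?thesis
    by (simp only: left_diff_distrib mult_1)
qed

end

lemma tendsto_prob_1I:
  assumes "\<forall>\<^sub>F i in F. prob_space (M i)" "\<forall>\<^sub>F i in F. f i \<le> measure (M i) (A i)" "(f \<longlongrightarrow> 1) F"
  shows "((\<lambda>i. measure (M i) (A i)) \<longlongrightarrow> 1) F"
proof (rule tendsto_sandwich)
  show "\<forall>\<^sub>F i in F. measure (M i) (A i) \<le> 1"
    using assms(1) by eventually_elim (rule prob_space.prob_le_1)
qed (use assms in simp_all)

section \<open>The clique number\<close>

lemma card_le_clique_number:
  assumes "finite V" "C \<subseteq> V" "clique C E"
  shows "card C \<le> clique_number V E"
  unfolding clique_number_def using assms by (intro Max_ge) auto

lemma measurable_clique_number:
  assumes "finite V"
    and edge: "\<And>u v. u \<in> V \<Longrightarrow> v \<in> V \<Longrightarrow> u \<noteq> v \<Longrightarrow> Measurable.pred M (\<lambda>\<omega>. {u, v} \<in> E \<omega>)"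
  shows "(\<lambda>\<omega>. clique_number V (E \<omega>)) \<in> measurable M (count_space UNIV)"
proof -
  have "Measurable.pred M (\<lambda>\<omega>. clique C (E \<omega>))" if "C \<subseteq> V" for C
    unfolding clique_def
  proof (intro pred_intros_finite)
    show "Measurable.pred M (\<lambda>\<omega>. u \<noteq> v \<longrightarrow> {u, v} \<in> E \<omega>)" if "u \<in> C" "v \<in> C" for u v
      using edge[of u v] that \<open>C \<subseteq> V\<close> by (cases "u = v") auto
  qed (use that \<open>finite V\<close> finite_subset in blast)+
  then have "Measurable.pred M (\<lambda>\<omega>. \<exists>C\<in>Pow V. k = card C \<and> clique C (E \<omega>))" for k
    using \<open>finite V\<close> by (intro pred_intros_finite pred_intros_logic) auto
  then have "(\<lambda>\<omega>. Max {k. \<exists>C\<in>Pow V. k = card C \<and> clique C (E \<omega>)}) \<in> measurable M (count_space UNIV)"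
    by (rule measurable_Max_nat)
  moreover have "card ` {C. C \<subseteq> V \<and> clique C E'} = {k. \<exists>C\<in>Pow V. k = card C \<and> clique C E'}" for E'
    by auto
  ultimately show ?thesis
    unfolding clique_number_def by simp
qed

section \<open>Adjacency on the torus\<close>

lemma circ_dist_commute: "circ_dist a b = circ_dist b a"
  by (simp add: circ_dist_def abs_minus_commute)

lemma circ_dist_le_half: "circ_dist a b \<le> 1 / 2"
  by (simp add: circ_dist_def min_def)

lemma torus_dist_commute: "torus_dist d x y = torus_dist d y x"
  by (simp add: torus_dist_def circ_dist_commute)

lemma torus_dist_le_half:
  assumes "1 \<le> d"
  shows "torus_dist d x y \<le> 1 / 2"
  unfolding torus_dist_def
proof (rule Max.boundedI)
  show "(\<lambda>i. circ_dist (x i) (y i)) ` {..<d} \<noteq> {}"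
    using assms by (auto simp: lessThan_empty_iff)
qed (auto intro: circ_dist_le_half simp del: le_divide_eq_numeral1)

lemma borel_measurable_torus_dist:
  assumes "X \<in> measurable M (\<Pi>\<^sub>M i\<in>{..<d}. lborel)" "Y \<in> measurable M (\<Pi>\<^sub>M i\<in>{..<d}. lborel)"
  shows "(\<lambda>\<omega>. torus_dist d (X \<omega>) (Y \<omega>)) \<in> borel_measurable M"
proof -
  have coord: "(\<lambda>\<omega>. Z \<omega> i) \<in> borel_measurable M"
    if "Z \<in> measurable M (\<Pi>\<^sub>M i\<in>{..<d}. lborel)" "i < d" for Z :: "_ \<Rightarrow> nat \<Rightarrow> real" and i
    using measurable_compose[OF that(1) measurable_component_singleton, of i] that(2) by simp
  show ?thesis
    unfolding torus_dist_def circ_dist_def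
    using assms coord by (intro borel_measurable_Max) auto
qed

lemma doubleton_in_girg_edges_iff:
  assumes "u < n" "v < n" "u \<noteq> v"
  shows "{u, v} \<in> girg_edges lam n d w x \<longleftrightarrow>
    torus_dist d (x u) (x v) \<le> 1 / 2 * (lam * w u * w v / real n) powr (1 / real d)"
    (is "_ \<longleftrightarrow> ?close u v")
proof
  assume "{u, v} \<in> girg_edges lam n d w x"
  then obtain u' v' where "{u, v} = {u', v'}" "?close u' v'"
    unfolding girg_edges_def by blast
  moreover have "?close u v \<longleftrightarrow> ?close v u"
    by (simp only: torus_dist_commute[of d "x v" "x u"] mult.assoc mult.commute[of "w v"])
  ultimately show "?close u v"
    by (auto simp only: doubleton_eq_iff)
next
  assume "?close u v"
  with assms show "{u, v} \<in> girg_edges lam n d w x"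
    unfolding girg_edges_def by blast
qed

lemma doubleton_in_girg_edges_if_le_weight_product:
  assumes "u < n" "v < n" "u \<noteq> v" "1 \<le> d" "real n \<le> lam * (w u * w v)"
  shows "{u, v} \<in> girg_edges lam n d w x"
proof -
  have "1 \<le> lam * w u * w v / real n"
    using assms by (simp add: mult.assoc)
  then have "1 \<le> (lam * w u * w v / real n) powr (1 / real d)"
    by (intro ge_one_powr_ge_zero) auto
  then have "torus_dist d (x u) (x v) \<le> 1 / 2 * (lam * w u * w v / real n) powr (1 / real d)"
    using torus_dist_le_half[OF \<open>1 \<le> d\<close>, of "x u" "x v"] by linarith
  then show ?thesis
    using assms by (simp add: doubleton_in_girg_edges_iff)
qed

definition heavy_vertices :: "nat \<Rightarrow> (nat \<Rightarrow> real) \<Rightarrow> real \<Rightarrow> nat set" where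
  "heavy_vertices n w t = {v\<in>{..<n}. t < w v}"

lemma clique_heavy_vertices:
  assumes "1 \<le> d" "0 \<le> lam" "0 \<le> t" "real n \<le> lam * t\<^sup>2"
  shows "clique (heavy_vertices n w t) (girg_edges lam n d w x)"
  unfolding clique_def
proof (intro ballI impI)
  fix u v
  assume uv: "u \<in> heavy_vertices n w t" "v \<in> heavy_vertices n w t" "u \<noteq> v"
  then have "t * t \<le> w u * w v"
    using \<open>0 \<le> t\<close> by (intro mult_mono) (auto simp: heavy_vertices_def)
  then have "lam * t\<^sup>2 \<le> lam * (w u * w v)"
    using \<open>0 \<le> lam\<close> by (simp add: power2_eq_square mult_left_mono)
  then have "real n \<le> lam * (w u * w v)"
    using assms by linarith
  then show "{u, v} \<in> girg_edges lam n d w x"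
    using uv \<open>1 \<le> d\<close> by (auto simp: heavy_vertices_def
        intro!: doubleton_in_girg_edges_if_le_weight_product)
qed

section \<open>The clique number of a GIRG\<close>

lemma mult_powr_mult_sqrt:
  fixes x a p :: real
  assumes "0 \<le> x" "0 \<le> a"
  shows "x * (a * sqrt x) powr p = a powr p * x powr (1 + p / 2)"
proof (cases "x = 0")
  case False
  then have "(a * sqrt x) powr p = a powr p * x powr (p / 2)"
    using assms by (simp add: powr_mult powr_powr flip: powr_half_sqrt)
  then show ?thesis
    using False assms by (simp add: powr_add)
qed simp

context girg
begin

definition clique_num :: "real \<Rightarrow> 'a \<Rightarrow> nat" where
  "clique_num lam \<omega> = clique_number {..<n} (girg_edges lam n d (\<lambda>v. W v \<omega>) (\<lambda>v. X v \<omega>))"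

lemma vertex_measurable:
  assumes "v < n"
  shows "(\<lambda>\<omega>. (W v \<omega>, X v \<omega>)) \<in> measurable M (borel \<Otimes>\<^sub>M (\<Pi>\<^sub>M i\<in>{..<d}. lborel))"
  using vertices_indep assms by (simp add: indep_vars_def2)

lemma weight_measurable: "v < n \<Longrightarrow> W v \<in> borel_measurable M"
  using measurable_fst'[OF vertex_measurable] by simp

lemma position_measurable: "v < n \<Longrightarrow> X v \<in> measurable M (\<Pi>\<^sub>M i\<in>{..<d}. lborel)"
  using measurable_snd'[OF vertex_measurable] by simp

lemma clique_num_measurable: "clique_num lam \<in> measurable M (count_space UNIV)"
  unfolding clique_num_def
proof (rule measurable_clique_number)
  fix u v assume "u \<in> {..<n}" "v \<in> {..<n}" and "u \<noteq> v"
  then have uv: "u < n" "v < n"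
    by auto
  note [measurable] = weight_measurable[OF uv(1)] weight_measurable[OF uv(2)]
    borel_measurable_torus_dist[OF position_measurable[OF uv(1)] position_measurable[OF uv(2)]]
  show "Measurable.pred M (\<lambda>\<omega>. {u, v} \<in> girg_edges lam n d (\<lambda>v. W v \<omega>) (\<lambda>v. X v \<omega>))"
    unfolding doubleton_in_girg_edges_iff[OF uv \<open>u \<noteq> v\<close>] by measurable
qed simp

lemma prob_weight_gt:
  assumes "v < n" "w0 \<le> t"
  shows "prob {\<omega> \<in> space M. t < W v \<omega>} = (t / w0) powr (1 - \<beta>)"
proof -
  have "{\<omega> \<in> space M. W v \<omega> \<le> t} \<in> events"
    using weight_measurable[OF assms(1)] by measurable
  from prob_neg[OF this] show ?thesis
    using weight_cdf[OF assms] by (simp add: not_le)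
qed

lemma indep_events_weight_gt: "indep_events (\<lambda>v. {\<omega> \<in> space M. t < W v \<omega>}) {..<n}"
proof -
  have "indep_events (\<lambda>v. {\<omega> \<in> space M. t < fst (W v \<omega>, X v \<omega>)}) {..<n}"
    using vertices_indep by (rule indep_eventsI_indep_vars) measurable
  then show ?thesis
    by simp
qed

lemma prob_card_heavy_vertices_gt:
  assumes "w0 \<le> t"
  defines "\<mu> \<equiv> real n * (t / w0) powr (1 - \<beta>)"
  shows "1 - exp (- \<mu> / 8)
    \<le> prob {\<omega> \<in> space M. \<mu> / 2 < real (card (heavy_vertices n (\<lambda>v. W v \<omega>) t))}"
proof -
  have mean: "(\<Sum>v<n. prob {\<omega> \<in> space M. t < W v \<omega>}) = \<mu>"
    using prob_weight_gt[OF _ assms(1)] by (simp add: \<mu>_def)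
  let ?few = "{\<omega> \<in> space M. real (card (heavy_vertices n (\<lambda>v. W v \<omega>) t)) \<le> \<mu> / 2}"
  have "prob ?few \<le> exp (- \<mu> / 8)"
    using Chernoff_ineq_indep_events_le[OF finite_lessThan indep_events_weight_gt, of "1 / 2" t]
    unfolding mean by (simp add: heavy_vertices_def power2_eq_square cong: conj_cong)
  moreover have "(\<lambda>\<omega>. card (heavy_vertices n (\<lambda>v. W v \<omega>) t)) \<in> measurable M (count_space UNIV)"
  proof (rule measurable_card)
    fix v
    show "{\<omega> \<in> space M. v \<in> heavy_vertices n (\<lambda>v. W v \<omega>) t} \<in> events"
      using weight_measurable[of v] by (cases "v < n") (simp_all add: heavy_vertices_def)
  qed
  then have "?few \<in> events"
    by measurable
  ultimately show ?thesis
    using prob_neg[of "\<lambda>\<omega>. real (card (heavy_vertices n (\<lambda>v. W v \<omega>) t)) \<le> \<mu> / 2"]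
    by (simp add: not_le)
qed

lemma prob_clique_num_ge:
  assumes "0 \<le> lam" "0 < w0" "w0 \<le> t" "real n \<le> lam * t\<^sup>2"
  defines "\<mu> \<equiv> real n * (t / w0) powr (1 - \<beta>)"
  shows "1 - exp (- \<mu> / 8) \<le> prob {\<omega> \<in> space M. \<mu> / 2 \<le> real (clique_num lam \<omega>)}"
proof -
  have "card (heavy_vertices n (\<lambda>v. W v \<omega>) t) \<le> clique_num lam \<omega>" for \<omega>
    unfolding clique_num_def using assms dim_pos
    by (intro card_le_clique_number clique_heavy_vertices) (auto simp: heavy_vertices_def)
  then have "{\<omega> \<in> space M. \<mu> / 2 < real (card (heavy_vertices n (\<lambda>v. W v \<omega>) t))}
      \<subseteq> {\<omega> \<in> space M. \<mu> / 2 \<le> real (clique_num lam \<omega>)}"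
    by (auto intro: order_trans[OF less_imp_le])
  moreover have "{\<omega> \<in> space M. \<mu> / 2 \<le> real (clique_num lam \<omega>)} \<in> events"
    using clique_num_measurable by measurable
  ultimately have "prob {\<omega> \<in> space M. \<mu> / 2 < real (card (heavy_vertices n (\<lambda>v. W v \<omega>) t))}
      \<le> prob {\<omega> \<in> space M. \<mu> / 2 \<le> real (clique_num lam \<omega>)}"
    by (rule finite_measure_mono)
  then show ?thesis
    using prob_card_heavy_vertices_gt[OF \<open>w0 \<le> t\<close>] unfolding \<mu>_def by linarith
qed

lemma prob_clique_num_ge_powr:
  assumes "1 \<le> n" "0 < lam" "0 < w0" "w0 \<le> B" "1 / sqrt lam \<le> B"
  defines "c \<equiv> (B / w0) powr (1 - \<beta>) / 2"
  shows "1 - exp (- (c * real n powr ((3 - \<beta>) / 2) / 4))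
    \<le> prob {\<omega> \<in> space M. c * real n powr ((3 - \<beta>) / 2) \<le> real (clique_num lam \<omega>)}"
proof -
  let ?t = "B * sqrt (real n)"
  have "B * 1 \<le> ?t"
    using assms by (intro mult_left_mono) auto
  then have "w0 \<le> ?t"
    using assms by linarith
  moreover have "real n \<le> lam * ?t\<^sup>2"
  proof -
    have "(1 / sqrt lam)\<^sup>2 \<le> B\<^sup>2"
      using assms by (intro power_mono) auto
    then have "1 \<le> lam * B\<^sup>2"
      using \<open>0 < lam\<close> by (simp add: field_simps)
    from mult_right_mono[OF this, of "real n"] show ?thesis
      by (simp add: power_mult_distrib)
  qed
  moreover have "real n * (?t / w0) powr (1 - \<beta>) = 2 * c * real n powr ((3 - \<beta>) / 2)"
  proof -
    have exponent: "(3 - \<beta>) / 2 = 1 + (1 - \<beta>) / 2"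
      by (simp add: field_simps)
    show ?thesis
      unfolding exponent using mult_powr_mult_sqrt[of "real n" "B / w0" "1 - \<beta>"] assms by (simp add: c_def)
  qed
  ultimately show ?thesis
    using prob_clique_num_ge[OF less_imp_le[OF \<open>0 < lam\<close>] \<open>0 < w0\<close>, of ?t] by simp
qed

end

theorem theorem18:
  fixes lam w0 \<beta> :: real
    and d :: "nat \<Rightarrow> nat"
    and M :: "nat \<Rightarrow> 'a measure"
    and W :: "nat \<Rightarrow> nat \<Rightarrow> 'a \<Rightarrow> real"
    and X :: "nat \<Rightarrow> nat \<Rightarrow> 'a \<Rightarrow> nat \<Rightarrow> real"
  assumes "0 < lam" and "0 < w0" and "2 < \<beta>" and "\<beta> < 3"
    and "\<And>n. 1 \<le> n \<Longrightarrow> girg (M n) n \<beta> w0 (d n) (W n) (X n)"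
  shows "\<exists>c>0. (\<lambda>n. measure (M n) {\<omega> \<in> space (M n).
           c * real n powr ((3 - \<beta>) / 2) \<le>
           real (clique_number {..<n}
             (girg_edges lam n (d n) (\<lambda>v. W n v \<omega>) (\<lambda>v. X n v \<omega>)))}) \<longlonglongrightarrow> 1"
proof -
  define c where "c = (max w0 (1 / sqrt lam) / w0) powr (1 - \<beta>) / 2"
  let ?k = "\<lambda>n. c * real n powr ((3 - \<beta>) / 2)"
  let ?p = "\<lambda>n. measure (M n) {\<omega> \<in> space (M n). ?k n \<le>
    real (clique_number {..<n} (girg_edges lam n (d n) (\<lambda>v. W n v \<omega>) (\<lambda>v. X n v \<omega>)))}"
  have "0 < c"
    using assms(2) by (simp add: c_def)
  have prob_space: "prob_space (M n)" and lower: "1 - exp (- (?k n / 4)) \<le> ?p n" if "1 \<le> n" for n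
  proof -
    interpret girg "M n" n \<beta> w0 "d n" "W n" "X n"
      using that by (rule assms(5))
    show "prob_space (M n)"
      by (rule prob_space_axioms)
    show "1 - exp (- (?k n / 4)) \<le> ?p n"
      using prob_clique_num_ge_powr[OF that assms(1,2) max.cobounded1 max.cobounded2]
      by (simp only: clique_num_def c_def)
  qed
  have "(\<lambda>n. 1 - exp (- (?k n / 4))) \<longlonglongrightarrow> 1"
    using \<open>0 < c\<close> \<open>\<beta> < 3\<close> by real_asymp
  with eventually_sequentiallyI[of 1, OF prob_space] eventually_sequentiallyI[of 1, OF lower] have "?p \<longlonglongrightarrow> 1"
    by (rule tendsto_prob_1I)
  with \<open>0 < c\<close> show ?thesis
    by blast
qed

end
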